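(* Let $C_n$ ($n\ge 3$) be the cycle on $n$ vertices. Then $\mathrm{UUSN}(C_n) = O(\log n)$ as $n\to\infty$; that is, there exist constants $K>0$ and $n_0$ such that $\mathrm{UUSN}(C_n)\le K\log n$ for all $n\ge n_0$.
   Context: Graphs are finite, simple and undirected. A valid labelling of a graph $G$ with universe a finite set $S$ assigns to the vertices of $G$ pairwise distinct nonempty subsets of $S$ such that two distinct vertices are adjacent if and only if their labels are disjoint. A valid labelling is uniform if all vertex labels have the same number of elements. The uniform universe size number $\mathrm{UUSN}(G)$ is the minimum of $|S|$ over all finite sets $S$ for which $G$ has a uniform valid labelling with universe $S$. *)

theory Defs
  imports Complex_Main "Graph_Theory.Pair_Digraph"
begin

text \<open>Finite simple undirected graphs are represented by \<^locale>\<open>pair_graph\<close>: finite,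
  loop-free, symmetric digraphs whose arcs are pairs of vertices.\<close>

definition cycle_graph :: "nat \<Rightarrow> nat pair_pre_digraph" where
  "cycle_graph n =
    \<lparr> pverts = {..<n},
      parcs = {(i, j). i < n \<and> j < n \<and> (j = (i + 1) mod n \<or> i = (j + 1) mod n)} \<rparr>"

definition valid_labelling :: "'a pair_pre_digraph \<Rightarrow> 'b set \<Rightarrow> ('a \<Rightarrow> 'b set) \<Rightarrow> bool" where
  "valid_labelling G S f \<longleftrightarrow>
     finite S \<and>
     (\<forall>v\<in>pverts G. f v \<noteq> {} \<and> f v \<subseteq> S) \<and>
     inj_on f (pverts G) \<and>
     (\<forall>u\<in>pverts G. \<forall>v\<in>pverts G. u \<noteq> v \<longrightarrow> ((u, v) \<in> parcs G \<longleftrightarrow> f u \<inter> f v = {}))"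

definition uniform_valid_labelling ::
    "'a pair_pre_digraph \<Rightarrow> 'b set \<Rightarrow> ('a \<Rightarrow> 'b set) \<Rightarrow> bool" where
  "uniform_valid_labelling G S f \<longleftrightarrow>
     valid_labelling G S f \<and> (\<forall>u\<in>pverts G. \<forall>v\<in>pverts G. card (f u) = card (f v))"

text \<open>Universes are taken among the finite sets of natural numbers. The lemmas
  \<open>uusn_attained\<close> and \<open>uusn_le\<close> below show that for every finite simple graph this is the
  minimum over finite universes of any type, and that it is attained.\<close>

definition uusn :: "'a pair_pre_digraph \<Rightarrow> nat" where
  "uusn G = (LEAST m. \<exists>(S :: nat set) f. uniform_valid_labelling G S f \<and> card S = m)"

lemma pair_graph_cycle_graph:
  assumes "n \<ge> 3"
  shows "pair_graph (cycle_graph n)"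
proof -
  have "finite (parcs (cycle_graph n))"
    by (rule finite_subset[of _ "{..<n} \<times> {..<n}"]) (auto simp: cycle_graph_def)
  moreover have "fst e \<noteq> snd e" if "e \<in> parcs (cycle_graph n)" for e
  proof -
    have "(i + 1) mod n \<noteq> i" if "i < n" for i
      using assms that by (cases "i + 1 = n") auto
    with that show ?thesis
      unfolding cycle_graph_def by fastforce
  qed
  moreover have "sym (parcs (cycle_graph n))"
    by (rule symI) (auto simp: cycle_graph_def)
  moreover have "finite (pverts (cycle_graph n))"
    by (simp add: cycle_graph_def)
  moreover have "fst e \<in> pverts (cycle_graph n)" "snd e \<in> pverts (cycle_graph n)"
    if "e \<in> parcs (cycle_graph n)" for e
    using that by (auto simp: cycle_graph_def)
  ultimately show ?thesis
    by unfold_locales (simp_all add: symmetric_def)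
qed

lemma uniform_valid_labelling_nat:
  fixes S :: "'b set"
  assumes "uniform_valid_labelling G S f"
  shows "\<exists>(T :: nat set) g. uniform_valid_labelling G T g \<and> card T = card S"
proof -
  have S: "finite S" and f: "\<And>v. v \<in> pverts G \<Longrightarrow> f v \<subseteq> S"
    using assms by (auto simp: uniform_valid_labelling_def valid_labelling_def)
  obtain h :: "'b \<Rightarrow> nat" where h: "inj_on h S"
    using finite_imp_inj_to_nat_seg[OF S] by blast
  have 1: "h ` f u = h ` f v \<longleftrightarrow> f u = f v"
    if "u \<in> pverts G" "v \<in> pverts G" for u v
    by (rule inj_on_image_eq_iff[OF h f[OF that(1)] f[OF that(2)]])
  have 2: "h ` f u \<inter> h ` f v = {} \<longleftrightarrow> f u \<inter> f v = {}"
    if "u \<in> pverts G" "v \<in> pverts G" for u v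
    using inj_on_image_Int[OF h f[OF that(1)] f[OF that(2)]] by (metis image_is_empty)
  have 3: "card (h ` f v) = card (f v)" if "v \<in> pverts G" for v
    using card_image[OF inj_on_subset[OF h f[OF that]]] .
  have L: "\<forall>v\<in>pverts G. f v \<noteq> {} \<and> f v \<subseteq> S" "inj_on f (pverts G)"
    "\<forall>u\<in>pverts G. \<forall>v\<in>pverts G. u \<noteq> v \<longrightarrow> ((u, v) \<in> parcs G \<longleftrightarrow> f u \<inter> f v = {})"
    "\<forall>u\<in>pverts G. \<forall>v\<in>pverts G. card (f u) = card (f v)"
    using assms unfolding uniform_valid_labelling_def valid_labelling_def by blast+
  have "\<forall>v\<in>pverts G. h ` f v \<noteq> {} \<and> h ` f v \<subseteq> h ` S"
    using L(1) by blast
  moreover have "inj_on (\<lambda>v. h ` f v) (pverts G)"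
    using L(2) 1 by (simp add: inj_on_def)
  moreover have "\<forall>u\<in>pverts G. \<forall>v\<in>pverts G.
      u \<noteq> v \<longrightarrow> ((u, v) \<in> parcs G \<longleftrightarrow> h ` f u \<inter> h ` f v = {})"
  proof (intro ballI impI)
    fix u v assume "u \<in> pverts G" "v \<in> pverts G" "u \<noteq> v"
    then show "(u, v) \<in> parcs G \<longleftrightarrow> h ` f u \<inter> h ` f v = {}"
      unfolding 2[OF \<open>u \<in> pverts G\<close> \<open>v \<in> pverts G\<close>] using L(3) by blast
  qed
  moreover have "\<forall>u\<in>pverts G. \<forall>v\<in>pverts G. card (h ` f u) = card (h ` f v)"
    using L(4) 3 by metis
  ultimately have "uniform_valid_labelling G (h ` S) (\<lambda>v. h ` f v)"
    unfolding uniform_valid_labelling_def valid_labelling_def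
    by (intro conjI finite_imageI S)
  then show ?thesis
    using card_image[OF h] by blast
qed

lemma uniform_valid_labelling_exists:
  assumes "pair_graph G"
  shows "\<exists>(S :: nat set) f. uniform_valid_labelling G S f"
proof -
  interpret pair_graph G by fact
  define e where "e v w = (if (v, w) \<in> parcs G then Inl (v, w) else Inr {v, w})" for v w
  define f where "f v = e v ` pverts G" for v
  have nl: "(v, v) \<notin> parcs G" for v
    using pair_no_loops by force
  have sym: "(v, u) \<in> parcs G" if "(u, v) \<in> parcs G" for u v
    using pair_sym_arcs that by (auto simp: symmetric_def dest: symD)
  have "inj_on (e v) (pverts G)" for v
    by (auto simp: inj_on_def e_def doubleton_eq_iff split: if_splits)
  then have card: "card (f v) = card (pverts G)" for v
    by (simp add: f_def card_image)
  have disj: "(u, v) \<in> parcs G \<longleftrightarrow> f u \<inter> f v = {}"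
    if "u \<in> pverts G" "v \<in> pverts G" "u \<noteq> v" for u v
  proof
    assume "(u, v) \<in> parcs G"
    then show "f u \<inter> f v = {}"
      using that sym by (auto simp: f_def e_def doubleton_eq_iff split: if_splits)
  next
    assume d: "f u \<inter> f v = {}"
    show "(u, v) \<in> parcs G"
    proof (rule ccontr)
      assume n: "(u, v) \<notin> parcs G"
      then have "e u v = e v u"
        using sym by (auto simp: e_def)
      then show False
        using d that by (auto simp: f_def)
    qed
  qed
  have "inj_on f (pverts G)"
  proof (rule inj_onI, rule ccontr)
    fix u v assume uv: "u \<in> pverts G" "v \<in> pverts G" "f u = f v" "u \<noteq> v"
    then have "e u u \<in> f v" by (auto simp: f_def)
    then show False
      using uv nl by (auto simp: f_def e_def doubleton_eq_iff split: if_splits)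
  qed
  then have "uniform_valid_labelling G (\<Union>v\<in>pverts G. f v) f"
    using disj card pair_finite_verts
    by (auto simp: uniform_valid_labelling_def valid_labelling_def f_def)
  then show ?thesis
    using uniform_valid_labelling_nat by blast
qed

lemma uusn_attained:
  assumes "pair_graph G"
  shows "\<exists>(S :: nat set) f. uniform_valid_labelling G S f \<and> card S = uusn G"
  unfolding uusn_def
  by (rule LeastI_ex) (use uniform_valid_labelling_exists[OF assms] in blast)

lemma uusn_le:
  fixes S :: "'b set"
  assumes "uniform_valid_labelling G S f"
  shows "uusn G \<le> card S"
  unfolding uusn_def by (rule Least_le) (rule uniform_valid_labelling_nat[OF assms])

end

theory Submission
  imports Defs
begin

text \<open>Given a fixed proper 3-colouring of the cycle and an independent set \<open>A\<close>, giving all of \<open>A\<close> a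
  fourth colour yields another proper colouring. For a family of independent sets, label a vertex by
  the list of colours it receives, that is, by the set of pairs (independent set, colour): all labels
  then have the same size, adjacent vertices have disjoint labels, and non-adjacent vertices have
  intersecting labels as soon as some set of the family contains both. For an arbitrary vertex set
  \<open>R\<close>, the \<open>v \<in> R\<close> whose successor is not in \<open>R\<close> form an independent set, which contains a given
  non-adjacent pair for at least 1/16 of all \<open>R\<close>. Greedily choosing the best \<open>R\<close>, \<open>O(log n)\<close> choices
  suffice to cover all of the at most \<open>n\<^sup>2\<close> pairs.\<close>

section \<open>Double counting and greedy covering\<close>

lemma sum_card_filter_swap:
  assumes "finite F" "finite X"
  shows "(\<Sum>R\<in>F. card {x\<in>X. P R x}) = (\<Sum>x\<in>X. card {R\<in>F. P R x})"
proof -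
  have "(\<Sum>R\<in>F. card {x\<in>X. P R x}) = (\<Sum>R\<in>F. \<Sum>x\<in>X. if P R x then 1 else 0)"
    using assms by (simp add: sum.If_cases Int_def)
  also have "\<dots> = (\<Sum>x\<in>X. \<Sum>R\<in>F. if P R x then 1 else 0)"
    by (rule sum.swap)
  also have "\<dots> = (\<Sum>x\<in>X. card {R\<in>F. P R x})"
    using assms by (simp add: sum.If_cases Int_def)
  finally show ?thesis .
qed

text \<open>Averaging: if every \<open>R\<close> failed, the sum of
  \<open>k * card {x\<in>X. P R x}\<close> over \<open>F\<close> would stay below
  \<open>card F * card X\<close>; counting the same pairs from the side of \<open>X\<close> gives at
  least that much.\<close>

lemma exists_dense_member:
  assumes "finite F" "F \<noteq> {}" "finite X"
    and dense: "\<And>x. x \<in> X \<Longrightarrow> card F \<le> k * card {R\<in>F. P R x}"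
  shows "\<exists>R\<in>F. card X \<le> k * card {x\<in>X. P R x}"
proof (rule ccontr)
  assume "\<not> ?thesis"
  then have "(\<Sum>R\<in>F. k * card {x\<in>X. P R x}) < (\<Sum>R\<in>F. card X)"
    using assms(1,2) by (intro sum_strict_mono) auto
  moreover have "(\<Sum>x\<in>X. card F) \<le> (\<Sum>x\<in>X. k * card {R\<in>F. P R x})"
    by (intro sum_mono dense)
  ultimately show False
    using sum_card_filter_swap[OF assms(1,3), of P]
    by (simp add: mult.commute flip: sum_distrib_left)
qed

text \<open>Each round applies the averaging argument to the elements not yet covered, so that at
  most a fraction \<open>1 - 1 / k\<close> of them survives.\<close>

lemma greedy_cover:
  assumes "finite F" "F \<noteq> {}" "finite X" "k > 0"
    and dense: "\<And>x. x \<in> X \<Longrightarrow> card F \<le> k * card {R\<in>F. P R x}"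
  shows "\<exists>D\<subseteq>F. card D \<le> m \<and>
    real (card {x\<in>X. \<forall>R\<in>D. \<not> P R x}) \<le> (1 - 1 / real k) ^ m * real (card X)"
proof (induction m)
  case 0
  show ?case by (intro exI[of _ "{}"]) simp
next
  case (Suc m)
  then obtain D where D: "D \<subseteq> F" "card D \<le> m"
    and le: "real (card {x\<in>X. \<forall>R\<in>D. \<not> P R x}) \<le> (1 - 1 / real k) ^ m * real (card X)"
    by blast
  define U where "U = {x\<in>X. \<forall>R\<in>D. \<not> P R x}"
  have "finite U" "U \<subseteq> X" using \<open>finite X\<close> by (auto simp: U_def)
  then obtain R where R: "R \<in> F" "card U \<le> k * card {x\<in>U. P R x}"
    using exists_dense_member[OF assms(1,2), of U k P] dense by blast
  have "card U = card {x\<in>U. P R x} + card {x\<in>U. \<not> P R x}"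
    using \<open>finite U\<close> by (subst card_Un_disjoint[symmetric]) (auto intro: arg_cong[where f = card])
  then have "real (card {x\<in>U. \<not> P R x}) = real (card U) - real (card {x\<in>U. P R x})"
    by simp
  also have "\<dots> \<le> (1 - 1 / real k) * real (card U)"
    using R(2) \<open>k > 0\<close> by (simp add: field_simps flip: of_nat_mult)
  also have "\<dots> \<le> (1 - 1 / real k) * ((1 - 1 / real k) ^ m * real (card X))"
    using le \<open>k > 0\<close> by (intro mult_left_mono) (auto simp: U_def)
  also have "{x\<in>U. \<not> P R x} = {x\<in>X. \<forall>R'\<in>insert R D. \<not> P R' x}"
    by (auto simp: U_def)
  finally have "real (card {x\<in>X. \<forall>R'\<in>insert R D. \<not> P R' x}) \<le>
      (1 - 1 / real k) ^ Suc m * real (card X)"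
    by (simp add: mult.assoc)
  moreover have "card (insert R D) \<le> Suc m"
    using D(2) card_insert_le_m1[of "Suc m" D R] by simp
  ultimately show ?case
    using D(1) R(1) by (intro exI[of _ "insert R D"]) simp
qed

text \<open>Membership is prescribed on \<open>B \<union> C\<close> and free elsewhere, so removing
  \<open>B\<close> matches the admissible \<open>R\<close> with the subsets of the rest.\<close>

lemma card_Pow_separating:
  assumes "finite V" "B \<subseteq> V" "C \<subseteq> V" "B \<inter> C = {}"
  shows "card (Pow V) = 2 ^ (card B + card C) * card {R\<in>Pow V. B \<subseteq> R \<and> R \<inter> C = {}}"
proof -
  have "bij_betw (\<lambda>R. R \<union> B) (Pow (V - (B \<union> C))) {R\<in>Pow V. B \<subseteq> R \<and> R \<inter> C = {}}"
    using assms by (intro bij_betw_byWitness[where f' = "\<lambda>R. R - B"]) auto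
  then have "card {R\<in>Pow V. B \<subseteq> R \<and> R \<inter> C = {}} = 2 ^ card (V - (B \<union> C))"
    using assms(1) by (simp add: card_Pow flip: bij_betw_same_card)
  moreover have "card V = card B + card C + card (V - (B \<union> C))"
  proof -
    have "finite B" "finite C"
      using assms finite_subset by blast+
    then show ?thesis
      using card_Un_disjoint[of B C] card_mono[of V "B \<union> C"] card_Diff_subset[of "B \<union> C" V] assms
      by simp
  qed
  ultimately show ?thesis
    using assms(1) by (simp add: card_Pow power_add)
qed

section \<open>Labellings from colourings and independent sets\<close>

lemma uniform_valid_labelling_of_independent_sets:
  fixes G :: "'a pair_pre_digraph" and col :: "'a \<Rightarrow> nat"
  assumes fin: "finite D" and ne: "D \<noteq> {}"
    and col: "\<And>v. v \<in> pverts G \<Longrightarrow> col v < k"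
    and proper: "\<And>u v. (u, v) \<in> parcs G \<Longrightarrow> col u \<noteq> col v"
    and indep: "\<And>A u v. A \<in> D \<Longrightarrow> u \<in> A \<Longrightarrow> v \<in> A \<Longrightarrow> (u, v) \<notin> parcs G"
    and cover: "\<And>u v. u \<in> pverts G \<Longrightarrow> v \<in> pverts G \<Longrightarrow> u \<noteq> v \<Longrightarrow> (u, v) \<notin> parcs G \<Longrightarrow>
      \<exists>A\<in>D. u \<in> A \<and> v \<in> A"
    and twinfree: "\<And>u v. u \<in> pverts G \<Longrightarrow> v \<in> pverts G \<Longrightarrow> u \<noteq> v \<Longrightarrow> (u, v) \<notin> parcs G \<Longrightarrow>
      \<exists>w\<in>pverts G. w \<noteq> v \<and> (u, w) \<in> parcs G \<and> (v, w) \<notin> parcs G"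
  shows "uniform_valid_labelling G (D \<times> {..k})
    (\<lambda>v. (\<lambda>A. (A, if v \<in> A then k else col v)) ` D)"
proof -
  define f where "f = (\<lambda>v. (\<lambda>A. (A, if v \<in> A then k else col v)) ` D)"
  have card: "card (f v) = card D" for v
    unfolding f_def by (rule card_image) (auto simp: inj_on_def)
  have nonempty: "f v \<noteq> {}" for v
    using ne by (simp add: f_def)
  have sub: "f v \<subseteq> D \<times> {..k}" if "v \<in> pverts G" for v
    using col[OF that] by (auto simp: f_def)
  have adj: "(u, v) \<in> parcs G \<longleftrightarrow> f u \<inter> f v = {}"
    if uv: "u \<in> pverts G" "v \<in> pverts G" "u \<noteq> v" for u v
  proof
    \<comment> \<open>A common pair \<open>(A, c)\<close> with \<open>c = k\<close> would put both
      ends into the independent set \<open>A\<close>, since \<open>col\<close> stays below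
      \<open>k\<close>; any other \<open>c\<close> would be a shared colour under
      \<open>col\<close>.\<close>
    assume "(u, v) \<in> parcs G"
    then show "f u \<inter> f v = {}"
      using proper[of u v] indep[of _ u v] col[OF uv(1)] col[OF uv(2)]
      by (auto simp: f_def split: if_splits)
  next
    assume "f u \<inter> f v = {}"
    moreover have "(A, k) \<in> f u \<inter> f v" if "A \<in> D" "u \<in> A" "v \<in> A" for A
      using that by (auto simp: f_def image_iff)
    ultimately show "(u, v) \<in> parcs G"
      using cover[OF uv] by blast
  qed
  have "inj_on f (pverts G)"
  proof (rule inj_onI, rule ccontr)
    fix u v assume uv: "u \<in> pverts G" "v \<in> pverts G" "f u = f v" "u \<noteq> v"
    then have "(u, v) \<notin> parcs G"
      using adj[of u v] nonempty[of v] by simp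
    \<comment> \<open>Vertices with equal labels would have the same adjacency to
      \<open>w\<close>.\<close>
    with uv obtain w where w: "w \<in> pverts G" "w \<noteq> v" "(u, w) \<in> parcs G" "(v, w) \<notin> parcs G"
      using twinfree by blast
    moreover have "w \<noteq> u"
      using w(3) proper by blast
    ultimately show False
      using adj[of u w] adj[of v w] uv by auto
  qed
  then have "uniform_valid_labelling G (D \<times> {..k}) f"
    using nonempty sub adj card fin
    by (simp add: uniform_valid_labelling_def valid_labelling_def)
  then show ?thesis
    by (simp add: f_def)
qed

section \<open>Independent sets and neighbourhoods in the cycle\<close>

definition descents :: "nat \<Rightarrow> nat set \<Rightarrow> nat set" where
  "descents n R = {i. i \<in> R \<and> (i + 1) mod n \<notin> R}"

lemma descents_independent:
  assumes "u \<in> descents n R" "v \<in> descents n R"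
  shows "(u, v) \<notin> parcs (cycle_graph n)"
  using assms by (auto simp: descents_def cycle_graph_def)

text \<open>Both vertices must lie in \<open>R\<close> and both successors outside. Non-adjacency
  makes these four vertices distinct, whence \<open>16 = 2 ^ 4\<close>.\<close>

lemma descents_dense:
  assumes "u < n" "v < n" "u \<noteq> v" "(u, v) \<notin> parcs (cycle_graph n)" "n \<ge> 3"
  shows "card (Pow {..<n}) \<le> 16 * card {R\<in>Pow {..<n}. u \<in> descents n R \<and> v \<in> descents n R}"
proof -
  let ?B = "{u, v}" and ?C = "{(u + 1) mod n, (v + 1) mod n}"
  have "?B \<inter> ?C = {}"
    using assms by (auto simp: cycle_graph_def mod_Suc split: if_splits)
  moreover have "card ?C = 2"
    using assms by (auto simp: mod_Suc split: if_splits)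
  ultimately have "card (Pow {..<n}) = 16 * card {R\<in>Pow {..<n}. ?B \<subseteq> R \<and> R \<inter> ?C = {}}"
    using card_Pow_separating[of "{..<n}" ?B ?C] assms by simp
  also have "{R\<in>Pow {..<n}. ?B \<subseteq> R \<and> R \<inter> ?C = {}} =
      {R\<in>Pow {..<n}. u \<in> descents n R \<and> v \<in> descents n R}"
    by (auto simp: descents_def)
  finally show ?thesis by simp
qed

text \<open>A vertex \<open>v\<close> other than \<open>u\<close> that is adjacent to both
  neighbours of \<open>u\<close> would close a 4-cycle, which \<open>n \<ge> 5\<close>
  excludes.\<close>

lemma cycle_graph_twinfree:
  assumes "n \<ge> 5" "u < n" "v < n" "u \<noteq> v" "(u, v) \<notin> parcs (cycle_graph n)"
  shows "\<exists>w<n. w \<noteq> v \<and> (u, w) \<in> parcs (cycle_graph n) \<and> (v, w) \<notin> parcs (cycle_graph n)"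
proof -
  define s where "s = (if u + 1 = n then 0 else u + 1)"
  define p where "p = (if u = 0 then n - 1 else u - 1)"
  have "s < n" "p < n" "(u, s) \<in> parcs (cycle_graph n)" "(u, p) \<in> parcs (cycle_graph n)"
    using assms by (auto simp: s_def p_def cycle_graph_def mod_Suc)
  moreover from this have "s \<noteq> v" "p \<noteq> v"
    using assms(5) by auto
  moreover have "(v, s) \<notin> parcs (cycle_graph n) \<or> (v, p) \<notin> parcs (cycle_graph n)"
    using assms \<open>s < n\<close> \<open>p < n\<close>
    by (auto simp: s_def p_def cycle_graph_def mod_Suc split: if_splits)
  ultimately show ?thesis by blast
qed

section \<open>The logarithmic bound\<close>

lemma uusn_cycle_graph_le:
  assumes "n \<ge> 5" and m: "(15 / 16) ^ m * (real n)\<^sup>2 < 1"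
  shows "uusn (cycle_graph n) \<le> 4 * (m + 1)"
proof -
  define X where "X = {(u, v). u < n \<and> v < n \<and> u \<noteq> v \<and> (u, v) \<notin> parcs (cycle_graph n)}"
  define P where "P R x \<longleftrightarrow> fst x \<in> descents n R \<and> snd x \<in> descents n R" for R x
  have X: "X \<subseteq> {..<n} \<times> {..<n}"
    by (auto simp: X_def)
  then have finX: "finite X"
    using finite_subset by blast
  have "card X \<le> n\<^sup>2"
    using card_mono[OF _ X] by (simp add: power2_eq_square)
  obtain D0 where D0: "D0 \<subseteq> Pow {..<n}" "card D0 \<le> m"
    and le: "real (card {x\<in>X. \<forall>R\<in>D0. \<not> P R x}) \<le> (1 - 1 / real 16) ^ m * real (card X)"
    using greedy_cover[of "Pow {..<n}" X 16 P m] finX descents_dense[of _ n] assms(1)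
    by (force simp: X_def P_def)
  note le
  also have "(1 - 1 / real 16) ^ m * real (card X) \<le> (15 / 16) ^ m * real (n\<^sup>2)"
    using \<open>card X \<le> n\<^sup>2\<close> by (intro mult_mono) (simp_all del: of_nat_power)
  also have "\<dots> < 1"
    using m by simp
  \<comment> \<open>A natural number below 1 is 0: after \<open>m\<close> rounds every non-adjacent
    pair is covered.\<close>
  finally have "card {x\<in>X. \<forall>R\<in>D0. \<not> P R x} = 0"
    by simp
  then have "{x\<in>X. \<forall>R\<in>D0. \<not> P R x} = {}"
    using finX by simp
  then have cover: "\<exists>R\<in>D0. u \<in> descents n R \<and> v \<in> descents n R" if "(u, v) \<in> X" for u v
    using that by (auto simp: P_def)
  \<comment> \<open>The empty set ensures \<open>D \<noteq> {}\<close> and accounts for the 1 in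
    \<open>m + 1\<close>; the factor 4 is the number of colours.\<close>
  define D where "D = insert {} (descents n ` D0)"
  have finD0: "finite D0"
    using D0(1) finite_subset by blast
  \<comment> \<open>Parities alternate along the path; colour 2 on the last vertex closes the cycle
    for even and odd \<open>n\<close> alike.\<close>
  define col where "col i = (if i + 1 = n then 2 else i mod 2)" for i :: nat
  have "uniform_valid_labelling (cycle_graph n) (D \<times> {..3})
      (\<lambda>v. (\<lambda>A. (A, if v \<in> A then 3 else col v)) ` D)"
  proof (rule uniform_valid_labelling_of_independent_sets)
    show "finite D" "D \<noteq> {}"
      using finD0 by (auto simp: D_def)
    show "col v < 3" for v
      by (auto simp: col_def)
    show "col u \<noteq> col v" if "(u, v) \<in> parcs (cycle_graph n)" for u v
    proof -
      have "col i \<noteq> col ((i + 1) mod n)" if "i < n" for i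
        using that assms(1) by (auto simp: col_def mod_Suc)
      then show ?thesis
        using that by (force simp: cycle_graph_def)
    qed
    show "(u, v) \<notin> parcs (cycle_graph n)" if "A \<in> D" "u \<in> A" "v \<in> A" for A u v
      using that descents_independent by (auto simp: D_def)
    show "\<exists>A\<in>D. u \<in> A \<and> v \<in> A"
      if "u \<in> pverts (cycle_graph n)" "v \<in> pverts (cycle_graph n)" "u \<noteq> v"
        "(u, v) \<notin> parcs (cycle_graph n)" for u v
    proof -
      have "(u, v) \<in> X"
        using that by (simp add: X_def) (simp add: cycle_graph_def)
      then show ?thesis
        using cover by (auto simp: D_def)
    qed
    show "\<exists>w\<in>pverts (cycle_graph n). w \<noteq> v \<and> (u, w) \<in> parcs (cycle_graph n) \<and>
        (v, w) \<notin> parcs (cycle_graph n)"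
      if "u \<in> pverts (cycle_graph n)" "v \<in> pverts (cycle_graph n)" "u \<noteq> v"
        "(u, v) \<notin> parcs (cycle_graph n)" for u v
    proof -
      have V: "pverts (cycle_graph n) = {..<n}"
        by (simp add: cycle_graph_def)
      show ?thesis
        using cycle_graph_twinfree[OF assms(1) _ _ that(3,4)] that(1,2) by (auto simp: V)
    qed
  qed
  then have "uusn (cycle_graph n) \<le> card (D \<times> {..3::nat})"
    by (rule uusn_le)
  also have "\<dots> = 4 * card D"
    by (simp add: card_cartesian_product)
  also have "card D \<le> m + 1"
    using card_image_le[OF finD0, of "descents n"] D0(2) finD0
    by (auto simp: D_def card_insert_if)
  finally show ?thesis by simp
qed

theorem theorem24:
  shows "\<exists>K>0. \<exists>n0::nat. \<forall>n\<ge>n0. n \<ge> 3 \<longrightarrow> real (uusn (cycle_graph n)) \<le> K * ln (real n)"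
proof -
  define c :: real where "c = ln (16 / 15)"
  have c: "c > 0"
    by (simp add: c_def)
  have "real (uusn (cycle_graph n)) \<le> (8 / c + 8) * ln (real n)" if n: "n \<ge> 5" for n
  proof -
    have ln1: "ln (real n) \<ge> 1"
      using n exp_le by (subst ln_ge_iff) auto
    \<comment> \<open>The least \<open>m\<close> with \<open>m * c > 2 * ln n\<close>, that is, with
      \<open>(15 / 16) ^ m * n\<^sup>2 < 1\<close>.\<close>
    define m where "m = nat \<lfloor>2 * ln (real n) / c\<rfloor> + 1"
    have "2 * ln (real n) / c \<ge> 0"
      using ln1 c by simp
    then have m: "2 * ln (real n) / c < real m" "real m \<le> 2 * ln (real n) / c + 1"
      unfolding m_def by linarith+
    have "ln ((15 / 16) ^ m * (real n)\<^sup>2) = 2 * ln (real n) - real m * c"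
      using n by (simp add: ln_mult ln_realpow c_def ln_div algebra_simps)
    also have "\<dots> < 0"
      using m(1) c by (simp add: field_simps)
    finally have "(15 / 16) ^ m * (real n)\<^sup>2 < 1"
      using n by (subst (asm) ln_less_zero_iff) auto
    then have "real (uusn (cycle_graph n)) \<le> real (4 * (m + 1))"
      using uusn_cycle_graph_le[OF n] of_nat_mono by blast
    also have "\<dots> \<le> 8 * ln (real n) / c + 8"
      using m(2) by simp
    \<comment> \<open>Since \<open>ln n \<ge> 1\<close>, the additive constant 8 is
      absorbed.\<close>
    also have "\<dots> \<le> (8 / c + 8) * ln (real n)"
      using ln1 by (simp add: algebra_simps)
    finally show ?thesis .
  qed
  moreover have "8 / c + 8 > 0"
    using c by (simp add: add_pos_pos)
  ultimately show ?thesis by blast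
qed

end
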